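(* Let $(G,d)$ be a $p$-uniformly convex space with constant $c>0$ and let $T:D\to G$ for $D\subset G$. (i) $\psi_T^{(p,c)}(x,y)=\tfrac c2d(Tx,x)^p$ for all $x\in D$ whenever $y\in\operatorname{Fix}T$. For fixed $y\in\operatorname{Fix}T$, $\psi_T^{(p,c)}(x,y)\ge0$ for all $x\in D$, and $\psi_T^{(p,c)}(x,y)=0$ only when $x\in\operatorname{Fix}T$. (ii) Let $y\in\operatorname{Fix}T$. $T$ is pointwise $\alpha$-firmly nonexpansive at $y$ on $D$ if and only if $$\exists\alpha\in(0,1):\quad d(Tx,y)^p\le d(x,y)^p-\tfrac{1-\alpha}{\alpha}\tfrac c2d(Tx,x)^p\quad\forall x\in D.$$ In particular, $T$ is quasi $\alpha$-firmly nonexpansive on $D$ whenever $T$ possesses fixed points and this inequality holds at all $y\in\operatorname{Fix}T$ with the same constant $\alpha\in(0,1)$. (iii) If $T$ is pointwise $\alpha$-firmly nonexpansive at $y\in\operatorname{Fix}T$ on $D$ with constant $\underline\alpha\in(0,1)$, then it is pointwise $\alpha$-firmly nonexpansive at $y$ on $D$ for all $\alpha\in[\underline\alpha,1]$. In particular, if $T$ is pointwise $\alpha$-firmly nonexpansive at $y\in\operatorname{Fix}T$ on $D$, then it is pointwise nonexpansive at $y$ on $D$. (iv) If at $y\in\operatorname{Fix}T$ $$\exists\lambda\in(0,1):\quad d(Tx,y)\le d((1-\lambda)x\oplus\lambda Tx,y)\quad\forall x\in D,$$ then $T$ is pointwise $\alpha$-firmly nonexpansive at $y$ with constant $\alpha=1/(\lambda+1)$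 on $D$. (v) Let $p=2$ and $c=2$ (that is, $(G,d)$ is a CAT(0) space). Then: (a) $\Delta_T^{(2,2)}(x,y)\le d(x,y)d(Tx,Ty)$ for all $x,y\in D$; (b) $\psi_T^{(2,2)}(x,y)\ge0$ for all $x,y\in D$; (c) for $y\in D$ and $\underline\alpha\in(0,1)$ the following are equivalent: (1) $T$ is pointwise $\alpha$-firmly nonexpansive at $y$ with constant $\underline\alpha$ on $D$; (2) $T$ is pointwise $\alpha$-firmly nonexpansive at $y$ for all constants $\alpha\in[\underline\alpha,1]$ on $D$; (3) $(1+\lambda)d(Tx,Ty)^2\le(1-\lambda)d(x,y)^2+2\lambda\Delta_T^{(2,2)}(x,y)$ for all $x\in D$ and all $\lambda\in[0,\tfrac{1-\underline\alpha}{\underline\alpha}]$; (d) if for some $\lambda\in(0,1)$ one has $d(Tx,Ty)\le d((1-\lambda)x\oplus\lambda Tx,(1-\lambda)y\oplus\lambda Ty)$ for all $x,y\in D$, then $T$ is $\alpha$-firmly nonexpansive with constant $\alpha=\tfrac1{1+\lambda}$ on $D$.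
   Context: Let $p\in(1,\infty)$. A metric space $(G,d)$ is $p$-uniformly convex with constant $c>0$ if it is a geodesic space and for all $x,y,z\in G$, $t\in[0,1]$: $$d(z,(1-t)x\oplus ty)^p\le(1-t)d(z,x)^p+td(z,y)^p-\tfrac c2t(1-t)d(x,y)^p,$$ where $(1-t)x\oplus ty$ is the point on the (unique) geodesic joining $x$ and $y$ at distance $t\,d(x,y)$ from $x$. A CAT(0) space is a $2$-uniformly convex space with constant $c=2$. $\operatorname{Fix}T=\{x\in D:Tx=x\}$. $\psi_T^{(p,c)}(x,y)=\tfrac c2\left(d(Tx,x)^p+d(Ty,y)^p+d(Tx,Ty)^p+d(x,y)^p-d(Tx,y)^p-d(x,Ty)^p\right)$ and $\Delta_T^{(p,c)}(x,y)=\tfrac c4\left(d(x,Ty)^p+d(y,Tx)^p-d(x,Tx)^p-d(y,Ty)^p\right)$. $T$ is pointwise $\alpha$-firmly nonexpansive at $y\in D$ on $D$ with constant $\alpha\in(0,1)$ if $d(Tx,Ty)^p\le d(x,y)^p-\tfrac{1-\alpha}{\alpha}\psi_T^{(p,c)}(x,y)$ for all $x\in D$; for $\alpha=1$ the same inequality (i.e. $d(Tx,Ty)\le d(x,y)$, pointwise nonexpansiveness at $y$ on $D$) is meant. $T$ is $\alpha$-firmly nonexpansive on $D$ with constant $\alpha$ if this holds at all $y\in D$ with the same $\alpha$; it is quasi $\alpha$-firmly nonexpansive on $D$ if $\operatorname{Fix}T\ne\emptyset$ and it holds at all $y\in\operatorname{Fix}T$ with the same $\alpha$. *)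

theory Defs
  imports "HOL-Analysis.Analysis"
begin

definition geodesic_between ::
  "'a set \<Rightarrow> ('a \<Rightarrow> 'a \<Rightarrow> real) \<Rightarrow> 'a \<Rightarrow> 'a \<Rightarrow> (real \<Rightarrow> 'a) \<Rightarrow> bool" where
  "geodesic_between G d x y \<gamma> \<longleftrightarrow>
     \<gamma> \<in> {0..d x y} \<rightarrow> G \<and> \<gamma> 0 = x \<and> \<gamma> (d x y) = y \<and>
     (\<forall>s\<in>{0..d x y}. \<forall>t\<in>{0..d x y}. d (\<gamma> s) (\<gamma> t) = \<bar>s - t\<bar>)"

definition geodesic_space :: "'a set \<Rightarrow> ('a \<Rightarrow> 'a \<Rightarrow> real) \<Rightarrow> bool" where
  "geodesic_space G d \<longleftrightarrow>
     Metric_space G d \<and> (\<forall>x\<in>G. \<forall>y\<in>G. \<exists>\<gamma>. geodesic_between G d x y \<gamma>)"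

text \<open>
  The point \<open>(1 - t) x \<oplus> t y\<close>. It is meaningful if \<open>0 \<le> t \<le> 1\<close> and geodesics
  are unique, which holds in \<open>p\<close>-uniformly convex spaces by
  \<open>p_uniformly_convex_space_unique\<close> below.
\<close>
definition geodesic_comb ::
  "'a set \<Rightarrow> ('a \<Rightarrow> 'a \<Rightarrow> real) \<Rightarrow> real \<Rightarrow> 'a \<Rightarrow> 'a \<Rightarrow> 'a" where
  "geodesic_comb G d t x y =
     (THE m. \<exists>\<gamma>. geodesic_between G d x y \<gamma> \<and> m = \<gamma> (t * d x y))"

text \<open>
  Uniqueness of geodesics is not assumed: the inequality is imposed along every
  geodesic, and this forces uniqueness. The equivalence with the formulation through
  \<^const>\<open>geodesic_comb\<close> is \<open>p_uniformly_convex_space_iff\<close> below.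
\<close>
definition p_uniformly_convex_space ::
  "'a set \<Rightarrow> ('a \<Rightarrow> 'a \<Rightarrow> real) \<Rightarrow> real \<Rightarrow> real \<Rightarrow> bool" where
  "p_uniformly_convex_space G d p c \<longleftrightarrow>
     1 < p \<and> 0 < c \<and> geodesic_space G d \<and>
     (\<forall>x\<in>G. \<forall>y\<in>G. \<forall>z\<in>G. \<forall>t\<in>{0..1}. \<forall>\<gamma>. geodesic_between G d x y \<gamma> \<longrightarrow>
        d z (\<gamma> (t * d x y)) powr p
          \<le> (1 - t) * d z x powr p + t * d z y powr p - c / 2 * t * (1 - t) * d x y powr p)"

definition Fix_on :: "'a set \<Rightarrow> ('a \<Rightarrow> 'a) \<Rightarrow> 'a set" where
  "Fix_on D T = {x \<in> D. T x = x}"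

definition psi ::
  "('a \<Rightarrow> 'a \<Rightarrow> real) \<Rightarrow> real \<Rightarrow> real \<Rightarrow> ('a \<Rightarrow> 'a) \<Rightarrow> 'a \<Rightarrow> 'a \<Rightarrow> real" where
  "psi d p c T x y =
     c / 2 * (d (T x) x powr p + d (T y) y powr p + d (T x) (T y) powr p + d x y powr p
              - d (T x) y powr p - d x (T y) powr p)"

definition Delta ::
  "('a \<Rightarrow> 'a \<Rightarrow> real) \<Rightarrow> real \<Rightarrow> real \<Rightarrow> ('a \<Rightarrow> 'a) \<Rightarrow> 'a \<Rightarrow> 'a \<Rightarrow> real" where
  "Delta d p c T x y =
     c / 4 * (d x (T y) powr p + d y (T x) powr p - d x (T x) powr p - d y (T y) powr p)"

text \<open>
  The constant \<open>\<alpha> = 1\<close> is admitted here; it gives pointwise nonexpansiveness by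
  \<open>ptwise_firmly_nonexpansive_1_iff\<close> below.
\<close>
definition ptwise_firmly_nonexpansive ::
  "('a \<Rightarrow> 'a \<Rightarrow> real) \<Rightarrow> real \<Rightarrow> real \<Rightarrow> real \<Rightarrow> 'a set \<Rightarrow> ('a \<Rightarrow> 'a) \<Rightarrow> 'a \<Rightarrow> bool" where
  "ptwise_firmly_nonexpansive d p c \<alpha> D T y \<longleftrightarrow>
     0 < \<alpha> \<and> \<alpha> \<le> 1 \<and> y \<in> D \<and>
     (\<forall>x\<in>D. d (T x) (T y) powr p \<le> d x y powr p - (1 - \<alpha>) / \<alpha> * psi d p c T x y)"

definition ptwise_nonexpansive ::
  "('a \<Rightarrow> 'a \<Rightarrow> real) \<Rightarrow> 'a set \<Rightarrow> ('a \<Rightarrow> 'a) \<Rightarrow> 'a \<Rightarrow> bool" where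
  "ptwise_nonexpansive d D T y \<longleftrightarrow> y \<in> D \<and> (\<forall>x\<in>D. d (T x) (T y) \<le> d x y)"

definition firmly_nonexpansive ::
  "('a \<Rightarrow> 'a \<Rightarrow> real) \<Rightarrow> real \<Rightarrow> real \<Rightarrow> real \<Rightarrow> 'a set \<Rightarrow> ('a \<Rightarrow> 'a) \<Rightarrow> bool" where
  "firmly_nonexpansive d p c \<alpha> D T \<longleftrightarrow>
     0 < \<alpha> \<and> \<alpha> < 1 \<and> (\<forall>y\<in>D. ptwise_firmly_nonexpansive d p c \<alpha> D T y)"

definition quasi_firmly_nonexpansive ::
  "('a \<Rightarrow> 'a \<Rightarrow> real) \<Rightarrow> real \<Rightarrow> real \<Rightarrow> real \<Rightarrow> 'a set \<Rightarrow> ('a \<Rightarrow> 'a) \<Rightarrow> bool" where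
  "quasi_firmly_nonexpansive d p c \<alpha> D T \<longleftrightarrow>
     0 < \<alpha> \<and> \<alpha> < 1 \<and> Fix_on D T \<noteq> {} \<and>
     (\<forall>y\<in>Fix_on D T. ptwise_firmly_nonexpansive d p c \<alpha> D T y)"

lemma ptwise_firmly_nonexpansive_1_iff:
  assumes "Metric_space G d" "0 < p"
  shows "ptwise_firmly_nonexpansive d p c 1 D T y \<longleftrightarrow> ptwise_nonexpansive d D T y"
proof -
  interpret Metric_space G d by fact
  have "a powr p \<le> b powr p \<longleftrightarrow> a \<le> b" if "0 \<le> a" "0 \<le> b" for a b :: real
    using that assms(2) by (meson linorder_not_less powr_less_mono2 powr_mono2 order_less_imp_le)
  then show ?thesis
    by (simp add: ptwise_firmly_nonexpansive_def ptwise_nonexpansive_def)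
qed

lemma p_uniformly_convex_space_unique:
  assumes puc: "p_uniformly_convex_space G d p c" and xy: "x \<in> G" "y \<in> G"
    and g: "geodesic_between G d x y \<gamma>" and g': "geodesic_between G d x y \<gamma>'"
    and t: "t \<in> {0..1}"
  shows "\<gamma> (t * d x y) = \<gamma>' (t * d x y)"
proof (rule ccontr)
  define L m w where "L = d x y" and "m = \<gamma> (t * L)" and "w = \<gamma>' (t * L)"
  assume "\<not> ?thesis"
  then have neq: "m \<noteq> w" by (simp add: L_def m_def w_def)
  have p: "1 < p" and c: "0 < c" and gs: "geodesic_space G d"
    and ineq: "\<And>x y z t \<gamma>. \<lbrakk>x \<in> G; y \<in> G; z \<in> G; t \<in> {0..1}; geodesic_between G d x y \<gamma>\<rbrakk> \<Longrightarrow>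
        d z (\<gamma> (t * d x y)) powr p
          \<le> (1 - t) * d z x powr p + t * d z y powr p - c / 2 * t * (1 - t) * d x y powr p"
    using puc unfolding p_uniformly_convex_space_def by auto
  interpret Metric_space G d using gs by (simp add: geodesic_space_def)
  have L0: "0 \<le> L" by (simp add: L_def)
  have tL: "t * L \<in> {0..L}" using t L0 by (auto simp: mult_left_le_one_le)
  have pt: "\<beta> (t * L) \<in> G \<and> d x (\<beta> (t * L)) = t * L \<and> d y (\<beta> (t * L)) = L - t * L"
    if "geodesic_between G d x y \<beta>" for \<beta>
  proof -
    have b: "\<beta> \<in> {0..L} \<rightarrow> G" "\<beta> 0 = x" "\<beta> L = y"
      "\<And>s t. \<lbrakk>s \<in> {0..L}; t \<in> {0..L}\<rbrakk> \<Longrightarrow> d (\<beta> s) (\<beta> t) = \<bar>s - t\<bar>"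
      using that by (auto simp: geodesic_between_def L_def)
    show ?thesis
      using b(1) b(4)[of 0 "t * L"] b(4)[of L "t * L"] tL L0 b(2,3) by (auto simp: Pi_iff)
  qed
  have mw: "m \<in> G" "w \<in> G" using pt g g' by (auto simp: m_def w_def)
  obtain \<delta> where del: "geodesic_between G d m w \<delta>"
    using gs mw by (auto simp: geodesic_space_def)
  define u where "u = \<delta> (1/2 * d m w)"
  have uG: "u \<in> G" using del unfolding geodesic_between_def u_def by (auto simp: Pi_iff)
  have pos: "0 < c / 2 * (1/2) * (1 - 1/2) * d m w powr p"
    using c neq mw by simp
  have lt: "d z u < r" if "z \<in> G" "d z m = r" "d z w = r" "0 \<le> r" for z r
  proof -
    have "d z u powr p < r powr p"
      using ineq[OF mw that(1) _ del, of "1/2"] that(2,3) pos unfolding u_def by (auto simp: field_simps)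
    then show ?thesis
      using p that(4) by (meson linorder_not_less powr_mono2 nonneg order_less_imp_le less_trans zero_less_one)
  qed
  have "d x u < t * L" "d y u < L - t * L"
    using lt[of x "t * L"] lt[of y "L - t * L"] pt[OF g] pt[OF g'] xy tL by (auto simp: m_def w_def)
  moreover have "L \<le> d x u + d y u"
    using triangle[of x u y] xy uG by (simp add: L_def commute)
  ultimately show False by simp
qed

lemma geodesic_comb_eq:
  assumes "p_uniformly_convex_space G d p c" "x \<in> G" "y \<in> G" "t \<in> {0..1}"
    and "geodesic_between G d x y \<gamma>"
  shows "geodesic_comb G d t x y = \<gamma> (t * d x y)"
  unfolding geodesic_comb_def
  using p_uniformly_convex_space_unique[OF assms(1-3) _ _ assms(4)] assms(5) by blast

lemma p_uniformly_convex_space_iff: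
  "p_uniformly_convex_space G d p c \<longleftrightarrow>
     1 < p \<and> 0 < c \<and> geodesic_space G d \<and>
     (\<forall>x\<in>G. \<forall>y\<in>G. \<forall>t\<in>{0..1}. \<forall>\<gamma> \<gamma>'.
        geodesic_between G d x y \<gamma> \<and> geodesic_between G d x y \<gamma>' \<longrightarrow>
        \<gamma> (t * d x y) = \<gamma>' (t * d x y)) \<and>
     (\<forall>x\<in>G. \<forall>y\<in>G. \<forall>z\<in>G. \<forall>t\<in>{0..1}.
        d z (geodesic_comb G d t x y) powr p
          \<le> (1 - t) * d z x powr p + t * d z y powr p - c / 2 * t * (1 - t) * d x y powr p)"
  (is "?L \<longleftrightarrow> 1 < p \<and> 0 < c \<and> geodesic_space G d \<and> ?U \<and> ?I")
proof
  assume L: ?L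
  have "?U" using p_uniformly_convex_space_unique[OF L] by blast
  moreover have "?I"
  proof (intro ballI)
    fix x y z and t :: real assume *: "x \<in> G" "y \<in> G" "z \<in> G" "t \<in> {0..1}"
    obtain \<gamma> where "geodesic_between G d x y \<gamma>"
      using L * unfolding p_uniformly_convex_space_def geodesic_space_def by metis
    then show "d z (geodesic_comb G d t x y) powr p
        \<le> (1 - t) * d z x powr p + t * d z y powr p - c / 2 * t * (1 - t) * d x y powr p"
      using geodesic_comb_eq[OF L *(1,2,4)] L * unfolding p_uniformly_convex_space_def by simp
  qed
  ultimately show "1 < p \<and> 0 < c \<and> geodesic_space G d \<and> ?U \<and> ?I"
    using L by (simp add: p_uniformly_convex_space_def)
next
  assume R: "1 < p \<and> 0 < c \<and> geodesic_space G d \<and> ?U \<and> ?I"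
  then have U: ?U and I: ?I by blast+
  have "d z (\<gamma> (t * d x y)) powr p
      \<le> (1 - t) * d z x powr p + t * d z y powr p - c / 2 * t * (1 - t) * d x y powr p"
    if *: "x \<in> G" "y \<in> G" "z \<in> G" "t \<in> {0..1}" "geodesic_between G d x y \<gamma>" for x y z t \<gamma>
  proof -
    have "geodesic_comb G d t x y = \<gamma> (t * d x y)"
      unfolding geodesic_comb_def
    proof (rule the_equality)
      show "\<exists>\<gamma>'. geodesic_between G d x y \<gamma>' \<and> \<gamma> (t * d x y) = \<gamma>' (t * d x y)"
        using * by blast
    next
      fix m assume "\<exists>\<gamma>'. geodesic_between G d x y \<gamma>' \<and> m = \<gamma>' (t * d x y)"
      then show "m = \<gamma> (t * d x y)" using U * by blast
    qed
    with I * show ?thesis by metis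
  qed
  with R show ?L unfolding p_uniformly_convex_space_def by blast
qed

end

theory Submission
  imports Defs
begin

text \<open>
  At a fixed point \<open>y\<close> the terms of \<^const>\<open>psi\<close> containing \<open>y\<close> cancel, which gives (i)--(iii);
  (iv) is the convexity inequality with third point \<open>y\<close>, divided by \<open>1 - \<lambda>\<close>.
  In a CAT(0) space \<open>\<psi>(x,y) = d(x,y)\<^sup>2 + d(Tx,Ty)\<^sup>2 - 2 \<Delta>(x,y)\<close>, so everything reduces to the
  quadrilateral inequality \<open>\<Delta>(x,y) \<le> d(x,y) d(Tx,Ty)\<close>. To prove it, take the point \<open>m\<close> with
  parameter \<open>t\<close> on the diagonal from \<open>x\<close> to \<open>Ty\<close>, estimate its distances to the other two
  vertices by convexity, and combine them through \<open>(u + v)\<^sup>2 \<le> u\<^sup>2 / t + v\<^sup>2 / (1 - t)\<close>;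
  the choice \<open>t = d(x,y) / (d(x,y) + d(Tx,Ty))\<close> is optimal.
\<close>

section \<open>Points on geodesics\<close>

lemma p_uniformly_convex_spaceD:
  assumes "p_uniformly_convex_space G d p c"
  shows "Metric_space G d" "1 < p" "0 < c"
  using assms by (auto simp: p_uniformly_convex_space_def geodesic_space_def)

lemma geodesic_comb_in:
  assumes "p_uniformly_convex_space G d p c" "x \<in> G" "y \<in> G" "t \<in> {0..1}"
  shows "geodesic_comb G d t x y \<in> G"
proof -
  interpret Metric_space G d using assms(1) by (rule p_uniformly_convex_spaceD)
  obtain \<gamma> where g: "geodesic_between G d x y \<gamma>"
    using assms unfolding p_uniformly_convex_space_def geodesic_space_def by metis
  have "t * d x y \<in> {0..d x y}"
    using assms(4) by (auto simp: mult_left_le_one_le)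
  then show ?thesis
    using g geodesic_comb_eq[OF assms g] by (auto simp: geodesic_between_def Pi_iff)
qed

text \<open>Passes from the inequality along every geodesic to the one for
  \<open>geodesic_comb\<close>; from here on geodesics enter only through this estimate and
  \<open>geodesic_comb_in\<close>.\<close>

lemma geodesic_comb_powr_le:
  assumes "p_uniformly_convex_space G d p c" "x \<in> G" "y \<in> G" "z \<in> G" "t \<in> {0..1}"
  shows "d z (geodesic_comb G d t x y) powr p
    \<le> (1 - t) * d z x powr p + t * d z y powr p - c / 2 * t * (1 - t) * d x y powr p"
  using assms unfolding p_uniformly_convex_space_iff by blast

section \<open>Firm nonexpansiveness at fixed points and monotonicity in the constant\<close>

lemma psi_Fix_on:
  assumes "Metric_space G d" "D \<subseteq> G" "T \<in> D \<rightarrow> G" "y \<in> Fix_on D T" "x \<in> D"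
  shows "psi d p c T x y = c / 2 * d (T x) x powr p"
proof -
  interpret Metric_space G d by fact
  show ?thesis using assms(2-) by (auto simp: psi_def Fix_on_def)
qed

lemma ptwise_firmly_nonexpansive_Fix_on_iff:
  assumes "Metric_space G d" "D \<subseteq> G" "T \<in> D \<rightarrow> G" "y \<in> Fix_on D T" "0 < \<alpha>" "\<alpha> \<le> 1"
  shows "ptwise_firmly_nonexpansive d p c \<alpha> D T y \<longleftrightarrow>
    (\<forall>x\<in>D. d (T x) y powr p \<le> d x y powr p - (1 - \<alpha>) / \<alpha> * (c / 2) * d (T x) x powr p)"
proof -
  have "y \<in> D" "T y = y" using assms(4) by (auto simp: Fix_on_def)
  then show ?thesis
    using assms(5,6)
    by (simp add: ptwise_firmly_nonexpansive_def psi_Fix_on[OF assms(1-4)] mult.assoc cong: ball_cong)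
qed

text \<open>The factor \<open>(1 - \<alpha>) / \<alpha>\<close> decreases in \<alpha>, so a larger
  constant subtracts less as long as \<open>psi\<close> is nonnegative. The sign is a hypothesis
  because it has two sources: \<open>y\<close> being a fixed point, or the CAT(0) inequality at
  arbitrary \<open>y\<close>.\<close>

lemma ptwise_firmly_nonexpansive_mono:
  assumes "ptwise_firmly_nonexpansive d p c \<alpha> D T y" "\<alpha> \<le> \<beta>" "\<beta> \<le> 1"
    and psi: "\<And>x. x \<in> D \<Longrightarrow> 0 \<le> psi d p c T x y"
  shows "ptwise_firmly_nonexpansive d p c \<beta> D T y"
proof -
  have \<alpha>: "0 < \<alpha>" "y \<in> D"
    and le: "\<And>x. x \<in> D \<Longrightarrow> d (T x) (T y) powr p \<le> d x y powr p - (1 - \<alpha>) / \<alpha> * psi d p c T x y"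
    using assms(1) by (auto simp: ptwise_firmly_nonexpansive_def)
  have "(1 - \<beta>) / \<beta> \<le> (1 - \<alpha>) / \<alpha>"
    using \<alpha> assms(2) by (simp add: field_simps)
  then have "(1 - \<beta>) / \<beta> * psi d p c T x y \<le> (1 - \<alpha>) / \<alpha> * psi d p c T x y" if "x \<in> D" for x
    using psi[OF that] by (rule mult_right_mono)
  with le have "d (T x) (T y) powr p \<le> d x y powr p - (1 - \<beta>) / \<beta> * psi d p c T x y" if "x \<in> D" for x
    using that by (smt (verit))
  with \<alpha> assms(2,3) show ?thesis by (auto simp: ptwise_firmly_nonexpansive_def)
qed

lemma ptwise_firmly_nonexpansive_Fix_onI:
  assumes puc: "p_uniformly_convex_space G d p c" and D: "D \<subseteq> G" "T \<in> D \<rightarrow> G"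
    and y: "y \<in> Fix_on D T" and t: "0 < t" "t < 1"
    and le: "\<And>x. x \<in> D \<Longrightarrow> d (T x) y \<le> d (geodesic_comb G d t x (T x)) y"
  shows "ptwise_firmly_nonexpansive d p c (1 / (t + 1)) D T y"
proof -
  have M: "Metric_space G d" and p: "1 < p" by (rule p_uniformly_convex_spaceD[OF puc])+
  interpret Metric_space G d by (rule M)
  have "d (T x) y powr p \<le> d x y powr p - t * (c / 2) * d (T x) x powr p" if x: "x \<in> D" for x
  proof -
    have G: "x \<in> G" "T x \<in> G" "y \<in> G"
      using x y D by (auto simp: Fix_on_def)
    have "d (T x) y powr p \<le> d (geodesic_comb G d t x (T x)) y powr p"
      using le[OF x] p by (intro powr_mono2) auto
    also have "\<dots> \<le> (1 - t) * d x y powr p + t * d (T x) y powr p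
        - c / 2 * t * (1 - t) * d (T x) x powr p"
      using geodesic_comb_powr_le[OF puc G, of t] t by (simp add: commute)
    \<comment> \<open>Moving \<open>t * d (T x) y powr p\<close> to the left leaves the factor
      \<open>1 - t\<close>, which the convexity defect also carries.\<close>
    finally have "(1 - t) * d (T x) y powr p
        \<le> (1 - t) * (d x y powr p - t * (c / 2) * d (T x) x powr p)"
      by (simp add: algebra_simps)
    then show ?thesis using t by simp
  qed
  \<comment> \<open>The constant \<open>1 / (t + 1)\<close> is the solution \<alpha> of
    \<open>(1 - \<alpha>) / \<alpha> = t\<close>.\<close>
  moreover have "(1 - 1 / (t + 1)) / (1 / (t + 1)) = t"
    using t by (simp add: field_simps)
  ultimately show ?thesis
    using t by (subst ptwise_firmly_nonexpansive_Fix_on_iff[OF M D y]) auto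
qed

section \<open>The quadrilateral inequality in CAT(0) spaces\<close>

lemma power2_add_le_weighted:
  fixes u v t :: real
  assumes "0 < t" "t < 1"
  shows "(u + v)\<^sup>2 \<le> u\<^sup>2 / t + v\<^sup>2 / (1 - t)"
proof -
  have "u\<^sup>2 / t + v\<^sup>2 / (1 - t) - (u + v)\<^sup>2 = ((1 - t) * u - t * v)\<^sup>2 / (t * (1 - t))"
    using assms by (simp add: field_simps power2_eq_square)
  also have "\<dots> \<ge> 0" using assms by simp
  finally show ?thesis by simp
qed

lemma CAT0_comb_power2_le:
  assumes "p_uniformly_convex_space G d 2 2" "x \<in> G" "y \<in> G" "z \<in> G" "t \<in> {0..1}"
  shows "(d z (geodesic_comb G d t x y))\<^sup>2
    \<le> (1 - t) * (d z x)\<^sup>2 + t * (d z y)\<^sup>2 - t * (1 - t) * (d x y)\<^sup>2"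
proof -
  interpret Metric_space G d using assms(1) by (rule p_uniformly_convex_spaceD)
  show ?thesis using geodesic_comb_powr_le[OF assms] by simp
qed

text \<open>The diagonals are \<open>a v\<close> and \<open>b u\<close>; the product is that of the
  opposite sides \<open>a b\<close> and \<open>u v\<close>. It is applied with \<open>a = x\<close>,
  \<open>b = y\<close>, \<open>u = T x\<close>, \<open>v = T y\<close>.\<close>

lemma CAT0_quadrilateral:
  assumes puc: "p_uniformly_convex_space G d 2 2" and G: "a \<in> G" "b \<in> G" "u \<in> G" "v \<in> G"
  shows "(d a v)\<^sup>2 + (d b u)\<^sup>2 \<le> (d a u)\<^sup>2 + (d b v)\<^sup>2 + 2 * d a b * d u v"
proof -
  interpret Metric_space G d using puc by (rule p_uniformly_convex_spaceD)
  show ?thesis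
  \<comment> \<open>If one of these sides degenerates, both sides of the inequality agree. Otherwise
    \<open>t\<close> lies strictly between 0 and 1, so dividing by \<open>t\<close> and
    \<open>1 - t\<close> is safe.\<close>
  proof (cases "a = b \<or> u = v")
    case True
    then show ?thesis using G by auto
  next
    case False
    define A B t where "A = d a b" and "B = d u v" and "t = A / (A + B)"
    have AB: "0 < A" "0 < B" using False G by (auto simp: A_def B_def)
    then have t: "0 < t" "t < 1" "t \<in> {0..1}" by (auto simp: t_def)
    define m where "m = geodesic_comb G d t a v"
    have m: "m \<in> G" unfolding m_def using puc G t by (intro geodesic_comb_in)
    have mb: "(d b m)\<^sup>2 \<le> (1 - t) * A\<^sup>2 + t * (d b v)\<^sup>2 - t * (1 - t) * (d a v)\<^sup>2"
      using CAT0_comb_power2_le[OF puc _ _ _ t(3), of a v b] G by (simp add: m_def A_def commute)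
    have mu: "(d u m)\<^sup>2 \<le> (1 - t) * (d a u)\<^sup>2 + t * B\<^sup>2 - t * (1 - t) * (d a v)\<^sup>2"
      using CAT0_comb_power2_le[OF puc _ _ _ t(3), of a v u] G by (simp add: m_def B_def commute)
    have "(d b u)\<^sup>2 \<le> (d b m + d u m)\<^sup>2"
      using triangle[of b m u] G m by (intro power_mono) (auto simp: commute)
    also have "\<dots> \<le> (d b m)\<^sup>2 / t + (d u m)\<^sup>2 / (1 - t)"
      by (rule power2_add_le_weighted[OF t(1,2)])
    also have "\<dots> \<le> ((1 - t) * A\<^sup>2 + t * (d b v)\<^sup>2 - t * (1 - t) * (d a v)\<^sup>2) / t
        + ((1 - t) * (d a u)\<^sup>2 + t * B\<^sup>2 - t * (1 - t) * (d a v)\<^sup>2) / (1 - t)"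
      using mb mu t by (intro add_mono divide_right_mono) auto
    \<comment> \<open>Only the last bracket depends on \<open>t\<close>. With
      \<open>s = (1 - t) / t\<close> it is \<open>s * A^2 + B^2 / s\<close>, minimal at
      \<open>s = B / A\<close> with value \<open>2 * A * B\<close>.\<close>
    also have "\<dots> = (d a u)\<^sup>2 + (d b v)\<^sup>2 - (d a v)\<^sup>2 + ((1 - t) / t * A\<^sup>2 + t / (1 - t) * B\<^sup>2)"
      using t by (simp add: field_simps)
    \<comment> \<open>This and the next equations are substituted into the bound;
      \<open>1 - t\<close> goes first, which fixes the shape of the two quotients below.\<close>
    also have "1 - t = B / (A + B)" using AB by (simp add: t_def field_simps)
    also have "B / (A + B) / t = B / A" using AB by (simp add: t_def)
    also have "t / (B / (A + B)) = A / B" using AB by (simp add: t_def)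
    also have "B / A * A\<^sup>2 + A / B * B\<^sup>2 = 2 * A * B"
      using AB by (simp add: power2_eq_square)
    finally show ?thesis by (simp add: A_def B_def)
  qed
qed

section \<open>Firm nonexpansiveness in CAT(0) spaces\<close>

lemma CAT0_Delta_eq:
  assumes "Metric_space G d"
  shows "Delta d 2 2 T x y = ((d x (T y))\<^sup>2 + (d y (T x))\<^sup>2 - (d x (T x))\<^sup>2 - (d y (T y))\<^sup>2) / 2"
proof -
  interpret Metric_space G d by fact
  show ?thesis by (simp add: Delta_def)
qed

lemma CAT0_psi_eq:
  assumes "Metric_space G d"
  shows "psi d 2 2 T x y = (d x y)\<^sup>2 + (d (T x) (T y))\<^sup>2 - 2 * Delta d 2 2 T x y"
proof -
  interpret Metric_space G d by fact
  show ?thesis by (simp add: psi_def CAT0_Delta_eq[OF assms] commute field_simps)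
qed

lemma CAT0_Delta_le:
  assumes puc: "p_uniformly_convex_space G d 2 2" and "D \<subseteq> G" "T \<in> D \<rightarrow> G" "x \<in> D" "y \<in> D"
  shows "Delta d 2 2 T x y \<le> d x y * d (T x) (T y)"
proof -
  have "x \<in> G" "y \<in> G" "T x \<in> G" "T y \<in> G" using assms by auto
  from CAT0_quadrilateral[OF puc this] show ?thesis
    by (simp add: CAT0_Delta_eq[OF p_uniformly_convex_spaceD(1)[OF puc]])
qed

text \<open>Bounding \<open>Delta\<close> by the product of distances gives \<open>psi\<close> at
  least \<open>(d x y - d (T x) (T y))^2\<close>.\<close>

lemma CAT0_psi_nonneg:
  assumes puc: "p_uniformly_convex_space G d 2 2" and "D \<subseteq> G" "T \<in> D \<rightarrow> G" "x \<in> D" "y \<in> D"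
  shows "0 \<le> psi d 2 2 T x y"
proof -
  have "0 \<le> (d x y - d (T x) (T y))\<^sup>2" by simp
  then show ?thesis
    using CAT0_Delta_le[OF assms]
    by (simp add: CAT0_psi_eq[OF p_uniformly_convex_spaceD(1)[OF puc]] power2_diff)
qed

text \<open>With \<alpha> = \<open>1 / (1 + \<mu>)\<close> the factor
  \<open>(1 - \<alpha>) / \<alpha>\<close> is \<mu>, so inserting the formula for \<open>psi\<close>
  leaves an inequality affine in \<mu>.\<close>

lemma CAT0_ptwise_firmly_nonexpansive_iff:
  assumes "Metric_space G d" "y \<in> D" "0 \<le> \<mu>"
  shows "ptwise_firmly_nonexpansive d 2 2 (1 / (1 + \<mu>)) D T y \<longleftrightarrow>
    (\<forall>x\<in>D. (1 + \<mu>) * (d (T x) (T y))\<^sup>2 \<le> (1 - \<mu>) * (d x y)\<^sup>2 + 2 * \<mu> * Delta d 2 2 T x y)"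
proof -
  interpret Metric_space G d by fact
  have "(1 - 1 / (1 + \<mu>)) / (1 / (1 + \<mu>)) = \<mu>" "0 < 1 / (1 + \<mu>)" "1 / (1 + \<mu>) \<le> 1"
    using assms(3) by (simp_all add: field_simps)
  then show ?thesis
    using assms(2)
    by (simp add: ptwise_firmly_nonexpansive_def CAT0_psi_eq[OF assms(1)] algebra_simps)
qed

text \<open>As \<mu> runs through the interval, \<open>1 / (1 + \<mu>)\<close> runs through all
  constants from \<alpha> to 1. One direction is therefore monotonicity.\<close>

lemma CAT0_ptwise_firmly_nonexpansive_iff_ball:
  assumes puc: "p_uniformly_convex_space G d 2 2" and D: "D \<subseteq> G" "T \<in> D \<rightarrow> G"
    and y: "y \<in> D" and \<alpha>: "0 < \<alpha>" "\<alpha> < 1"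
  shows "ptwise_firmly_nonexpansive d 2 2 \<alpha> D T y \<longleftrightarrow>
    (\<forall>x\<in>D. \<forall>\<mu>\<in>{0..(1 - \<alpha>) / \<alpha>}.
      (1 + \<mu>) * (d (T x) (T y))\<^sup>2 \<le> (1 - \<mu>) * (d x y)\<^sup>2 + 2 * \<mu> * Delta d 2 2 T x y)"
    (is "?L \<longleftrightarrow> (\<forall>x\<in>D. \<forall>\<mu>\<in>?I. ?Q \<mu> x)")
proof -
  note M = p_uniformly_convex_spaceD(1)[OF puc]
  have "?L \<longleftrightarrow> (\<forall>\<mu>\<in>?I. ptwise_firmly_nonexpansive d 2 2 (1 / (1 + \<mu>)) D T y)"
  proof
    assume L: ?L
    show "\<forall>\<mu>\<in>?I. ptwise_firmly_nonexpansive d 2 2 (1 / (1 + \<mu>)) D T y"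
    proof
      fix \<mu> assume "\<mu> \<in> ?I"
      then have "\<alpha> \<le> 1 / (1 + \<mu>)" "1 / (1 + \<mu>) \<le> 1" using \<alpha> by (auto simp: field_simps)
      then show "ptwise_firmly_nonexpansive d 2 2 (1 / (1 + \<mu>)) D T y"
        using L CAT0_psi_nonneg[OF puc D _ y] by (intro ptwise_firmly_nonexpansive_mono[OF L])
    qed
  next
    assume "\<forall>\<mu>\<in>?I. ptwise_firmly_nonexpansive d 2 2 (1 / (1 + \<mu>)) D T y"
    \<comment> \<open>The right endpoint of the interval gives back \<alpha> itself.\<close>
    moreover have "(1 - \<alpha>) / \<alpha> \<in> ?I" "1 / (1 + (1 - \<alpha>) / \<alpha>) = \<alpha>"
      using \<alpha> by (auto simp: field_simps)
    ultimately show ?L by metis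
  qed
  also have "\<dots> \<longleftrightarrow> (\<forall>\<mu>\<in>?I. \<forall>x\<in>D. ?Q \<mu> x)"
    using CAT0_ptwise_firmly_nonexpansive_iff[OF M y] by (intro ball_cong) auto
  finally show ?thesis by blast
qed

text \<open>Convexity is used first along the geodesic from \<open>y\<close> to \<open>T y\<close>,
  seen from the fixed point \<open>m\<close>, and then along the one from \<open>x\<close> to
  \<open>T x\<close>, seen from \<open>y\<close> and from \<open>T y\<close>.\<close>

lemma CAT0_comb_comb_power2_le:
  assumes puc: "p_uniformly_convex_space G d 2 2" and G: "x \<in> G" "y \<in> G" "T x \<in> G" "T y \<in> G"
    and t: "t \<in> {0..1}"
  shows "(d (geodesic_comb G d t x (T x)) (geodesic_comb G d t y (T y)))\<^sup>2
    \<le> (1 - t)\<^sup>2 * (d x y)\<^sup>2 + t\<^sup>2 * (d (T x) (T y))\<^sup>2 + 2 * t * (1 - t) * Delta d 2 2 T x y"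
proof -
  interpret Metric_space G d using puc by (rule p_uniformly_convex_spaceD)
  define m where "m = geodesic_comb G d t x (T x)"
  have m: "m \<in> G" unfolding m_def using puc G t by (intro geodesic_comb_in)
  have my: "(d m y)\<^sup>2 \<le> (1 - t) * (d x y)\<^sup>2 + t * (d y (T x))\<^sup>2 - t * (1 - t) * (d x (T x))\<^sup>2"
    using CAT0_comb_power2_le[OF puc G(1,3,2) t] by (simp add: m_def commute)
  have mTy: "(d m (T y))\<^sup>2
      \<le> (1 - t) * (d x (T y))\<^sup>2 + t * (d (T x) (T y))\<^sup>2 - t * (1 - t) * (d x (T x))\<^sup>2"
    using CAT0_comb_power2_le[OF puc G(1,3,4) t] by (simp add: m_def commute)
  have "(d m (geodesic_comb G d t y (T y)))\<^sup>2
      \<le> (1 - t) * (d m y)\<^sup>2 + t * (d m (T y))\<^sup>2 - t * (1 - t) * (d y (T y))\<^sup>2"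
    by (rule CAT0_comb_power2_le[OF puc G(2,4) m t])
  also have "\<dots> \<le> (1 - t) * ((1 - t) * (d x y)\<^sup>2 + t * (d y (T x))\<^sup>2 - t * (1 - t) * (d x (T x))\<^sup>2)
      + t * ((1 - t) * (d x (T y))\<^sup>2 + t * (d (T x) (T y))\<^sup>2 - t * (1 - t) * (d x (T x))\<^sup>2)
      - t * (1 - t) * (d y (T y))\<^sup>2"
    using my mTy t by (intro diff_right_mono add_mono mult_left_mono) auto
  \<comment> \<open>The two \<open>d x (T x)\<close> terms have weights \<open>1 - t\<close> and
    \<open>t\<close>, so they add up to a single \<open>- t * (1 - t)\<close>; together with the
    \<open>y\<close> term and the mixed distances this is the \<open>Delta\<close> term.\<close>
  also have "\<dots> = (1 - t)\<^sup>2 * (d x y)\<^sup>2 + t\<^sup>2 * (d (T x) (T y))\<^sup>2 + 2 * t * (1 - t) * Delta d 2 2 T x y"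
    unfolding CAT0_Delta_eq[OF Metric_space_axioms] by (simp add: field_simps power2_eq_square)
  finally show ?thesis by (simp add: m_def)
qed

lemma CAT0_firmly_nonexpansiveI:
  assumes puc: "p_uniformly_convex_space G d 2 2" and D: "D \<subseteq> G" "T \<in> D \<rightarrow> G"
    and t: "0 < t" "t < 1"
    and le: "\<And>x y. x \<in> D \<Longrightarrow> y \<in> D \<Longrightarrow>
      d (T x) (T y) \<le> d (geodesic_comb G d t x (T x)) (geodesic_comb G d t y (T y))"
  shows "firmly_nonexpansive d 2 2 (1 / (1 + t)) D T"
proof -
  interpret Metric_space G d using puc by (rule p_uniformly_convex_spaceD)
  have "(1 + t) * (d (T x) (T y))\<^sup>2 \<le> (1 - t) * (d x y)\<^sup>2 + 2 * t * Delta d 2 2 T x y"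
    if xy: "x \<in> D" "y \<in> D" for x y
  proof -
    have G: "x \<in> G" "y \<in> G" "T x \<in> G" "T y \<in> G" using xy D by auto
    have "(d (T x) (T y))\<^sup>2
        \<le> (d (geodesic_comb G d t x (T x)) (geodesic_comb G d t y (T y)))\<^sup>2"
      using le[OF xy] by (intro power_mono) auto
    also have "\<dots> \<le> (1 - t)\<^sup>2 * (d x y)\<^sup>2 + t\<^sup>2 * (d (T x) (T y))\<^sup>2
        + 2 * t * (1 - t) * Delta d 2 2 T x y"
      using CAT0_comb_comb_power2_le[where t = t, OF puc G] t by simp
    \<comment> \<open>Absorbing the \<open>t^2\<close> term on the left gives
      \<open>1 - t^2\<close>, so \<open>1 - t\<close> is a common factor.\<close>
    finally have "(1 - t) * ((1 + t) * (d (T x) (T y))\<^sup>2)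
        \<le> (1 - t) * ((1 - t) * (d x y)\<^sup>2 + 2 * t * Delta d 2 2 T x y)"
      by (simp add: algebra_simps power2_eq_square)
    then show ?thesis using t by simp
  qed
  then have "\<forall>y\<in>D. ptwise_firmly_nonexpansive d 2 2 (1 / (1 + t)) D T y"
    using t by (simp add: CAT0_ptwise_firmly_nonexpansive_iff[OF Metric_space_axioms])
  then show ?thesis using t by (simp add: firmly_nonexpansive_def)
qed

theorem proposition4:
  fixes G D :: "'a set" and d :: "'a \<Rightarrow> 'a \<Rightarrow> real" and p c :: real and T :: "'a \<Rightarrow> 'a"
  assumes "p_uniformly_convex_space G d p c" and "D \<subseteq> G" and "T \<in> D \<rightarrow> G"
  shows
    "(\<forall>y\<in>Fix_on D T.
        (\<forall>x\<in>D. psi d p c T x y = c / 2 * d (T x) x powr p) \<and>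
        (\<forall>x\<in>D. 0 \<le> psi d p c T x y) \<and>
        (\<forall>x\<in>D. psi d p c T x y = 0 \<longrightarrow> x \<in> Fix_on D T))
     \<and>
     (\<forall>y\<in>Fix_on D T.
        (\<exists>\<alpha>\<in>{0<..<1}. ptwise_firmly_nonexpansive d p c \<alpha> D T y) \<longleftrightarrow>
        (\<exists>\<alpha>\<in>{0<..<1}. \<forall>x\<in>D.
           d (T x) y powr p \<le> d x y powr p - (1 - \<alpha>) / \<alpha> * (c / 2) * d (T x) x powr p))
     \<and>
     (\<forall>\<alpha>\<in>{0<..<1}.
        Fix_on D T \<noteq> {} \<and>
        (\<forall>y\<in>Fix_on D T. \<forall>x\<in>D.
           d (T x) y powr p \<le> d x y powr p - (1 - \<alpha>) / \<alpha> * (c / 2) * d (T x) x powr p) \<longrightarrow>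
        quasi_firmly_nonexpansive d p c \<alpha> D T)
     \<and>
     (\<forall>y\<in>Fix_on D T. \<forall>\<alpha>0\<in>{0<..<1}.
        ptwise_firmly_nonexpansive d p c \<alpha>0 D T y \<longrightarrow>
        (\<forall>\<alpha>\<in>{\<alpha>0..1}. ptwise_firmly_nonexpansive d p c \<alpha> D T y))
     \<and>
     (\<forall>y\<in>Fix_on D T.
        (\<exists>\<alpha>\<in>{0<..<1}. ptwise_firmly_nonexpansive d p c \<alpha> D T y) \<longrightarrow>
        ptwise_nonexpansive d D T y)
     \<and>
     (\<forall>y\<in>Fix_on D T. \<forall>\<mu>\<in>{0<..<1}.
        (\<forall>x\<in>D. d (T x) y \<le> d (geodesic_comb G d \<mu> x (T x)) y) \<longrightarrow>
        ptwise_firmly_nonexpansive d p c (1 / (\<mu> + 1)) D T y)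
     \<and>
     (p = 2 \<and> c = 2 \<longrightarrow>
        (\<forall>x\<in>D. \<forall>y\<in>D. Delta d 2 2 T x y \<le> d x y * d (T x) (T y))
        \<and>
        (\<forall>x\<in>D. \<forall>y\<in>D. 0 \<le> psi d 2 2 T x y)
        \<and>
        (\<forall>y\<in>D. \<forall>\<alpha>0\<in>{0<..<1}.
           (ptwise_firmly_nonexpansive d 2 2 \<alpha>0 D T y \<longleftrightarrow>
              (\<forall>\<alpha>\<in>{\<alpha>0..1}. ptwise_firmly_nonexpansive d 2 2 \<alpha> D T y)) \<and>
           (ptwise_firmly_nonexpansive d 2 2 \<alpha>0 D T y \<longleftrightarrow>
              (\<forall>x\<in>D. \<forall>\<mu>\<in>{0..(1 - \<alpha>0) / \<alpha>0}.
                 (1 + \<mu>) * (d (T x) (T y))^2 \<le> (1 - \<mu>) * (d x y)^2 + 2 * \<mu> * Delta d 2 2 T x y)))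
        \<and>
        (\<forall>\<mu>\<in>{0<..<1}.
           (\<forall>x\<in>D. \<forall>y\<in>D.
              d (T x) (T y) \<le> d (geodesic_comb G d \<mu> x (T x)) (geodesic_comb G d \<mu> y (T y))) \<longrightarrow>
           firmly_nonexpansive d 2 2 (1 / (1 + \<mu>)) D T))"
proof -
  note puc = assms(1) and D = assms(2,3)
  have M: "Metric_space G d" and p: "1 < p" and c: "0 < c"
    by (rule p_uniformly_convex_spaceD[OF puc])+
  interpret Metric_space G d by (rule M)
  note psi = psi_Fix_on[OF M D, where p = p and c = c]
  note fne = ptwise_firmly_nonexpansive_Fix_on_iff[OF M D, where p = p and c = c]
  have psi_nonneg: "0 \<le> psi d p c T x y" if "y \<in> Fix_on D T" "x \<in> D" for x y
    unfolding psi[OF that] using c by simp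
  have psi_zero: "x \<in> Fix_on D T" if "y \<in> Fix_on D T" "x \<in> D" "psi d p c T x y = 0" for x y
  proof -
    have "d (T x) x = 0" using psi[OF that(1,2)] that(3) c by simp
    then show ?thesis using that(2) D by (auto simp: Fix_on_def Pi_iff subset_iff)
  qed
  have mono: "ptwise_firmly_nonexpansive d p c \<beta> D T y"
    if "y \<in> Fix_on D T" "ptwise_firmly_nonexpansive d p c \<alpha> D T y" "\<alpha> \<le> \<beta>" "\<beta> \<le> 1" for y \<alpha> \<beta>
    using ptwise_firmly_nonexpansive_mono[OF that(2-4) psi_nonneg[OF that(1)]] .
  \<comment> \<open>Monotonicity up to the constant 1, where the \<open>psi\<close> term
    vanishes.\<close>
  have ne: "ptwise_nonexpansive d D T y"
    if "y \<in> Fix_on D T" "\<alpha> \<in> {0<..<1}" "ptwise_firmly_nonexpansive d p c \<alpha> D T y" for y \<alpha>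
    using mono[OF that(1,3), of 1] that(2) ptwise_firmly_nonexpansive_1_iff[OF M, of p] p by simp
  \<comment> \<open>The converse is the instance \<beta> = \<alpha>.\<close>
  have CAT0_mono: "ptwise_firmly_nonexpansive d 2 2 \<alpha> D T y \<longleftrightarrow>
      (\<forall>\<beta>\<in>{\<alpha>..1}. ptwise_firmly_nonexpansive d 2 2 \<beta> D T y)"
    if "p_uniformly_convex_space G d 2 2" "y \<in> D" "\<alpha> \<in> {0<..<1}" for y \<alpha>
    using that ptwise_firmly_nonexpansive_mono[OF _ _ _ CAT0_psi_nonneg[OF that(1) D _ that(2)]]
    by fastforce
  show ?thesis
  proof (intro conjI ballI impI, goal_cases)
    case (1 y x) then show ?case by (rule psi)
  next
    case (2 y x) then show ?case by (rule psi_nonneg)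
  next
    case (3 y x) then show ?case by (rule psi_zero)
  next
    case (4 y) then show ?case using fne[OF 4] by (intro bex_cong) auto
  next
    case (5 \<alpha>) then show ?case using fne[of _ \<alpha>] by (auto simp: quasi_firmly_nonexpansive_def)
  next
    case (6 y \<alpha>0 \<alpha>) then show ?case using mono by auto
  next
    case (7 y) then show ?case using ne by blast
  next
    case (8 y \<mu>) then show ?case
      by (intro ptwise_firmly_nonexpansive_Fix_onI[OF puc D]) auto
  next
    case (9 x y) then show ?case using CAT0_Delta_le[OF _ D] puc by blast
  next
    case (10 x y) then show ?case using CAT0_psi_nonneg[OF _ D] puc by blast
  next
    case (11 y \<alpha>0) then show ?case using CAT0_mono puc by blast
  next
    case (12 y \<alpha>0) then show ?case
      using CAT0_ptwise_firmly_nonexpansive_iff_ball[OF _ D] puc by auto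
  next
    case (13 \<mu>) then show ?case
      using puc by (intro CAT0_firmly_nonexpansiveI[OF _ D]) auto
  qed
qed

end
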